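(* For every integer $n\ge 0$, the function $\mathcal{H}_n(\lambda):=\mathcal{H}(\phi_n)$ is given, as a polynomial in $\lambda$, by $$\mathcal{H}_n(\lambda)=-\frac{(4\lambda)^{2n+1}F_{-1}^2}{2}+(4\lambda)^{n}F_{-1}F_n+\sum_{j=0}^{n-1}(4\lambda)^{n-1-j}\left[F_jF_n-\int F_j'F_n\,dx\right].$$
   Context: Let $q$ be a smooth complex-valued function of $x$ on an open interval; $'$ denotes $d/dx$, and $\lambda$ is a parameter independent of $x$. Let $B$ be the linear operator $B(f)=f'''+4qf'+2q'f$. The functions $F_n$ ($n\ge -1$) are defined recursively by $F_{-1}=\tfrac12$ and $F_{n+1}=\int B(F_n)\,dx$, i.e. $F_{n+1}'=B(F_n)$, with all constants of integration equal to zero: for $n\ge0$, $F_n$ is a differential polynomial in $q$ (a polynomial in $q,q',q'',\dots$) with zero constant term. Thus $F_0=q$, $F_1=q''+3q^2$, etc. Set $\phi_n=(4\lambda)^nF_{-1}+(4\lambda)^{n-1}F_0+\cdots+(4\lambda)F_{n-2}+F_{n-1}=\sum_{j=0}^{n}(4\lambda)^{n-j}F_{j-1}$. For a function $\phi$ of $x$, define $$\mathcal{H}(\phi):=\phi\phi''-\tfrac12(\phi')^2+2(q-\lambda)\phi^2,$$ which is also $\int\phi B(\phi)\,dx-2\lambda\phi^2$. In the claim, $\int F_j'F_n\,dx$ denotes the antiderivative of $F_j'F_n$ that is a differential polynomial in $q$ with zero constant term. *)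

theory Defs
  imports "HOL-Analysis.Analysis" "HOL-Library.Poly_Mapping"
begin

text \<open>
  Differential polynomials are elements of the polynomial ring over the complex numbers in
  the indeterminates \<open>u\<^sub>0, u\<^sub>1, u\<^sub>2, \<dots>\<close>, where \<open>u\<^sub>k\<close> stands for the \<open>k\<close>-th derivative
  of \<open>q\<close>. Antiderivatives have to be taken in this formal ring: for a particular function \<open>q\<close>
  (a constant one, say) "the antiderivative that is a differential polynomial in \<open>q\<close> with zero
  constant term" is not determined as a function.
\<close>

type_synonym diffpoly = "(nat \<Rightarrow>\<^sub>0 nat) \<Rightarrow>\<^sub>0 complex"

definition const_dp :: "complex \<Rightarrow> diffpoly" where
  "const_dp c = Poly_Mapping.single 0 c"

definition jet :: "nat \<Rightarrow> diffpoly" where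
  "jet k = Poly_Mapping.single (Poly_Mapping.single k 1) 1"

definition const_term :: "diffpoly \<Rightarrow> complex" where
  "const_term P = Poly_Mapping.lookup P 0"

text \<open>
  The total derivative: the \<open>\<complex>\<close>-linear derivation with \<open>u\<^sub>k \<mapsto> u\<^sub>k\<^sub>+\<^sub>1\<close>, i.e.
  \<open>\<Sum>k. (\<partial>P / \<partial>u\<^sub>k) u\<^sub>k\<^sub>+\<^sub>1\<close>, written out on the monomials \<open>m\<close> of \<open>P\<close>.
\<close>

definition total_deriv :: "diffpoly \<Rightarrow> diffpoly" where
  "total_deriv P =
     (\<Sum>m\<in>Poly_Mapping.keys P. \<Sum>k\<in>Poly_Mapping.keys m.
        Poly_Mapping.single (m - Poly_Mapping.single k 1)
          (Poly_Mapping.lookup P m * of_nat (Poly_Mapping.lookup m k)) * jet (Suc k))"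

text \<open>A differential polynomial with zero constant term is determined by its total derivative,
  so the description below is proper exactly when \<open>P\<close> is a total derivative. The functions
  \<open>B(F\<^sub>n)\<close> and \<open>F\<^sub>j' F\<^sub>n\<close> to which it gets applied are total derivatives; this is not assumed but has
  to be proved about the definitions.\<close>

definition antideriv :: "diffpoly \<Rightarrow> diffpoly" where
  "antideriv P = (THE Q. total_deriv Q = P \<and> const_term Q = 0)"

definition B_op :: "diffpoly \<Rightarrow> diffpoly" where
  "B_op P = total_deriv (total_deriv (total_deriv P))
     + 4 * jet 0 * total_deriv P + 2 * total_deriv (jet 0) * P"

primrec F_shifted :: "nat \<Rightarrow> diffpoly" where
  "F_shifted 0 = const_dp (1 / 2)"
| "F_shifted (Suc k) = antideriv (B_op (F_shifted k))"

text \<open>\<open>F n\<close> is meant for \<open>n \<ge> -1\<close>.\<close>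

definition F :: "int \<Rightarrow> diffpoly" where
  "F n = F_shifted (nat (n + 1))"

definition ddx :: "(real \<Rightarrow> complex) \<Rightarrow> real \<Rightarrow> complex" where
  "ddx f = (\<lambda>x. vector_derivative f (at x))"

definition smooth_on :: "real set \<Rightarrow> (real \<Rightarrow> complex) \<Rightarrow> bool" where
  "smooth_on I f \<longleftrightarrow> (\<forall>k. \<forall>x\<in>I. (ddx ^^ k) f differentiable (at x))"

definition eval_dp :: "(real \<Rightarrow> complex) \<Rightarrow> diffpoly \<Rightarrow> real \<Rightarrow> complex" where
  "eval_dp q P x =
     (\<Sum>m\<in>Poly_Mapping.keys P. Poly_Mapping.lookup P m *
        (\<Prod>k\<in>Poly_Mapping.keys m. ((ddx ^^ k) q x) ^ Poly_Mapping.lookup m k))"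

definition phi :: "(real \<Rightarrow> complex) \<Rightarrow> complex \<Rightarrow> nat \<Rightarrow> real \<Rightarrow> complex" where
  "phi q l n x = (\<Sum>j=0..n. (4 * l) ^ (n - j) * eval_dp q (F (int j - 1)) x)"

definition H_op :: "(real \<Rightarrow> complex) \<Rightarrow> complex \<Rightarrow> (real \<Rightarrow> complex) \<Rightarrow> real \<Rightarrow> complex" where
  "H_op q l \<phi> x =
     \<phi> x * ddx (ddx \<phi>) x - 1 / 2 * (ddx \<phi> x)\<^sup>2 + 2 * (q x - l) * (\<phi> x)\<^sup>2"

end

theory Submission
  imports Defs
begin

text \<open>Both sides come from differential polynomials, so it suffices to compare their total
  derivatives and their constant terms, as only constants have zero total derivative. Now
  \<open>\<H>(\<phi>)' = \<phi> (B(\<phi>) - 4\<lambda>\<phi>')\<close>, and for \<open>\<phi> = \<phi>\<^sub>n\<close> the recursion makes \<open>B(\<phi>\<^sub>n) - 4\<lambda>\<phi>\<^sub>n'\<close>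
  telescope to \<open>F\<^sub>n'\<close>; the right-hand side visibly has derivative \<open>\<phi>\<^sub>n F\<^sub>n'\<close>. The antiderivatives
  exist because \<open>B\<close> is skew-adjoint.\<close>

section \<open>Induction principles for differential polynomials\<close>

abbreviation (input) expo :: "nat \<Rightarrow> nat \<Rightarrow>\<^sub>0 nat" where
  "expo k \<equiv> Poly_Mapping.single k (Suc 0)"

text \<open>Every finitely supported map is a finite sum of single-point maps. The zero map needs no
  case of its own, as it is a single-point map with value 0.\<close>

lemma poly_mapping_single_add_induct [case_names single add]:
  fixes p :: "'a \<Rightarrow>\<^sub>0 'b::comm_monoid_add"
  assumes single: "\<And>m c. R (Poly_Mapping.single m c)"
    and add: "\<And>p q. R p \<Longrightarrow> R q \<Longrightarrow> R (p + q)"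
  shows "R p"
proof (induction p rule: update_induct)
  case const
  show ?case using single[of undefined 0] by simp
next
  case (update f a b)
  have "Poly_Mapping.update a b f = f + Poly_Mapping.single a b"
    using update(1)
    by (intro poly_mapping_eqI) (auto simp: lookup_add lookup_update lookup_single in_keys_iff)
  then show ?case using add update single by metis
qed

lemma jet_power: "jet k ^ n = Poly_Mapping.single (Poly_Mapping.single k n) 1"
  by (induction n) (auto simp: jet_def mult_single single_add[symmetric])

lemma single_conv_const: "(Poly_Mapping.single m c :: diffpoly) = const_dp c * Poly_Mapping.single m 1"
  by (simp add: const_dp_def mult_single)

text \<open>The ring is generated as an algebra by the jets. This reduces statements about
  derivations and homomorphisms to their values on the generators.\<close>

lemma diffpoly_induct [case_names const jet add mult]:
  assumes const: "\<And>c. R (const_dp c)" and jet: "\<And>k. R (jet k)"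
    and add: "\<And>P Q. R P \<Longrightarrow> R Q \<Longrightarrow> R (P + Q)"
    and mult: "\<And>P Q. R P \<Longrightarrow> R Q \<Longrightarrow> R (P * Q)"
  shows "R P"
proof -
  have pow: "R (jet k ^ n)" for k n
    using const[of 1] by (induction n) (auto simp: const_dp_def intro: jet mult)
  have mono: "R (Poly_Mapping.single m 1)" for m
  proof (induction m rule: poly_mapping_single_add_induct)
    case (single k n)
    then show ?case using pow by (simp add: jet_power)
  next
    case (add p q)
    then show ?case using mult[OF add] by (simp add: mult_single)
  qed
  show ?thesis
  proof (induction P rule: poly_mapping_single_add_induct)
    case (single m c)
    show ?case by (subst single_conv_const) (intro mult const mono)
  qed (rule add)
qed

section \<open>Constants and the Leibniz rule for the total derivative\<close>

lemma const_dp_mult: "const_dp (a * b) = const_dp a * const_dp b"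
  by (simp add: const_dp_def mult_single)

lemma const_dp_diff: "const_dp (a - b) = const_dp a - const_dp b"
  by (simp add: const_dp_def single_diff)

lemma const_dp_power: "const_dp (a ^ n) = const_dp a ^ n"
  by (induction n) (simp_all add: const_dp_mult, simp add: const_dp_def)

lemma const_dp_0 [simp]: "const_dp 0 = 0"
  and const_dp_1 [simp]: "const_dp 1 = 1"
  and const_dp_numeral [simp]: "const_dp (numeral n) = numeral n"
  by (simp_all add: const_dp_def)

lemma half_mult [simp]: "2 * const_dp (1/2) = 1"
  using const_dp_mult[of 2 "1/2"] by simp

lemma total_deriv_single:
  "total_deriv (Poly_Mapping.single m c) =
     (\<Sum>k\<in>Poly_Mapping.keys m. Poly_Mapping.single (m - expo k)
        (c * of_nat (Poly_Mapping.lookup m k)) * jet (Suc k))"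
  by (simp add: total_deriv_def)

lemma total_deriv_add: "total_deriv (P + Q) = total_deriv P + total_deriv Q"
  unfolding total_deriv_def
  by (rule setsum_keys_plus_distrib) (simp_all add: algebra_simps single_add sum.distrib)

text \<open>Subtraction of exponents is truncated at 0, so it is compatible with addition only when
  \<open>k\<close> really occurs in \<open>m\<close>.\<close>

lemma diff_expo_add:
  assumes "k \<in> Poly_Mapping.keys m"
  shows "m + n - expo k = (m - expo k) + n"
  using assms by (intro poly_mapping_eqI)
    (auto simp: lookup_add minus_poly_mapping.rep_eq lookup_single in_keys_iff when_def)

text \<open>The summand belonging to \<open>k\<close> is additive in the exponent of
  \<open>k\<close> and vanishes at exponent 0. Hence the sum over the keys of \<open>m + n\<close>
  splits into one over the keys of \<open>m\<close> and one over those of \<open>n\<close>.\<close>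

lemma total_deriv_single_mult:
  "total_deriv (Poly_Mapping.single m c * Poly_Mapping.single n d) =
     total_deriv (Poly_Mapping.single m c) * Poly_Mapping.single n d
     + Poly_Mapping.single m c * total_deriv (Poly_Mapping.single n d)"
proof -
  let ?f = "\<lambda>k a. Poly_Mapping.single (m + n - expo k) (c * d * of_nat a) * jet (Suc k)"
  have "total_deriv (Poly_Mapping.single m c * Poly_Mapping.single n d)
      = (\<Sum>k\<in>Poly_Mapping.keys (m + n). ?f k (Poly_Mapping.lookup (m + n) k))"
    by (simp add: mult_single total_deriv_single)
  also have "\<dots> = (\<Sum>k\<in>Poly_Mapping.keys m. ?f k (Poly_Mapping.lookup m k))
      + (\<Sum>k\<in>Poly_Mapping.keys n. ?f k (Poly_Mapping.lookup n k))"
    by (rule setsum_keys_plus_distrib) (simp_all add: algebra_simps single_add)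
  also have "(\<Sum>k\<in>Poly_Mapping.keys m. ?f k (Poly_Mapping.lookup m k))
      = total_deriv (Poly_Mapping.single m c) * Poly_Mapping.single n d"
    unfolding total_deriv_single sum_distrib_right
    by (intro sum.cong) (simp_all add: diff_expo_add jet_def mult_single ac_simps)
  also have "(\<Sum>k\<in>Poly_Mapping.keys n. ?f k (Poly_Mapping.lookup n k))
      = Poly_Mapping.single m c * total_deriv (Poly_Mapping.single n d)"
    unfolding total_deriv_single sum_distrib_left
    by (intro sum.cong)
      (simp_all add: diff_expo_add[of _ n m, simplified add.commute[of n m]] jet_def mult_single
        ac_simps)
  finally show ?thesis .
qed

lemma total_deriv_mult: "total_deriv (P * Q) = total_deriv P * Q + P * total_deriv Q"
proof (induction P rule: poly_mapping_single_add_induct)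
  case (single m c)
  show ?case
    by (induction Q rule: poly_mapping_single_add_induct)
      (simp_all add: total_deriv_single_mult total_deriv_add algebra_simps)
qed (simp add: total_deriv_add algebra_simps)

lemma total_deriv_const [simp]: "total_deriv (const_dp c) = 0"
  by (simp add: const_dp_def total_deriv_single)

lemma total_deriv_0 [simp]: "total_deriv 0 = 0"
  and total_deriv_numeral [simp]: "total_deriv (numeral n) = 0"
  using total_deriv_const[of 0] total_deriv_const[of "numeral n"]
  by (simp_all del: total_deriv_const)

lemma total_deriv_minus: "total_deriv (- P) = - total_deriv P"
  using total_deriv_add[of P "- P"] by (simp add: eq_neg_iff_add_eq_0 add.commute)

lemma total_deriv_diff: "total_deriv (P - Q) = total_deriv P - total_deriv Q"
  using total_deriv_add[of P "- Q"] by (simp add: total_deriv_minus)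

lemma total_deriv_const_mult: "total_deriv (const_dp c * P) = const_dp c * total_deriv P"
  by (simp add: total_deriv_mult)

lemma total_deriv_sum: "total_deriv (\<Sum>i\<in>A. f i) = (\<Sum>i\<in>A. total_deriv (f i))"
  by (induction A rule: infinite_finite_induct) (simp_all add: total_deriv_add)

lemma total_deriv_jet [simp]: "total_deriv (jet k) = jet (Suc k)"
  by (simp add: jet_def[of k] total_deriv_single)

section \<open>The constant term as a ring homomorphism\<close>

lemma const_term_add: "const_term (P + Q) = const_term P + const_term Q"
  by (simp add: const_term_def lookup_add)

lemma const_term_diff: "const_term (P - Q) = const_term P - const_term Q"
  by (simp add: const_term_def lookup_minus)

lemma const_term_minus: "const_term (- P) = - const_term P"
  by (simp add: const_term_def)

lemma const_term_const [simp]: "const_term (const_dp c) = c"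
  by (simp add: const_term_def const_dp_def)

lemma const_term_0 [simp]: "const_term 0 = 0"
  by (simp add: const_term_def)

lemma const_term_numeral [simp]: "const_term (numeral n) = numeral n"
  by (metis const_dp_numeral const_term_const)

lemma const_term_sum: "const_term (\<Sum>i\<in>A. f i) = (\<Sum>i\<in>A. const_term (f i))"
  by (induction A rule: infinite_finite_induct) (simp_all add: const_term_add)

lemma exponents_add_eq_0_iff: "(m :: nat \<Rightarrow>\<^sub>0 nat) + n = 0 \<longleftrightarrow> m = 0 \<and> n = 0"
  by (auto simp: poly_mapping_eq_iff fun_eq_iff lookup_add)

text \<open>Exponents are natural numbers, so the trivial monomial factors only trivially.\<close>

lemma const_term_mult: "const_term (P * Q) = const_term P * const_term Q"
proof (induction P rule: poly_mapping_single_add_induct)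
  case (single m c)
  show ?case
    by (induction Q rule: poly_mapping_single_add_induct)
      (auto simp: mult_single const_term_def lookup_single when_def exponents_add_eq_0_iff
         lookup_add algebra_simps)
qed (simp add: const_term_add algebra_simps)

lemma const_term_power: "const_term (P ^ n) = const_term P ^ n"
  by (induction n) (simp_all add: const_term_mult, simp add: const_term_def)

lemma const_term_jet [simp]: "const_term (jet k) = 0"
  by (simp add: const_term_def jet_def lookup_single when_def poly_mapping_eq_iff fun_eq_iff)

lemma const_term_total_deriv [simp]: "const_term (total_deriv P) = 0"
  by (induction P rule: diffpoly_induct)
    (simp_all add: total_deriv_add total_deriv_mult const_term_add const_term_mult)

section \<open>Kernel of the total derivative and uniqueness of antiderivatives\<close>

text \<open>If \<open>P\<close> is not constant, let \<open>N\<close> be the highest order of a jet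
  in it and \<open>m0\<close> a monomial containing \<open>jet N\<close>. Replacing one factor
  \<open>jet N\<close> of \<open>m0\<close> by \<open>jet (Suc N)\<close> gives a monomial of the
  total derivative that arises in no other way. Its coefficient is that of \<open>m0\<close> times a
  positive exponent, hence nonzero.\<close>

lemma total_deriv_eq_0D:
  assumes "total_deriv P = 0"
  shows "P = const_dp (const_term P)"
proof (cases "\<exists>m\<in>Poly_Mapping.keys P. m \<noteq> 0")
  case False
  then have "Poly_Mapping.lookup P m = 0" if "m \<noteq> 0" for m
    using that by (auto simp: in_keys_iff)
  then show ?thesis
    by (intro poly_mapping_eqI)
      (auto simp: const_dp_def const_term_def lookup_single when_def)
next
  case True
  let ?V = "\<Union>m\<in>Poly_Mapping.keys P. Poly_Mapping.keys m"
  define N where "N = Max ?V"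
  have V: "finite ?V" "?V \<noteq> {}"
    using True by auto
  from Max_in[OF V] obtain m0 where m0: "m0 \<in> Poly_Mapping.keys P" "N \<in> Poly_Mapping.keys m0"
    by (auto simp: N_def)
  have le: "k \<le> N" if "m \<in> Poly_Mapping.keys P" "k \<in> Poly_Mapping.keys m" for m k
    using Max_ge[OF V(1)] that unfolding N_def by blast
  have above: "Poly_Mapping.lookup m (Suc N) = 0" if "m \<in> Poly_Mapping.keys P" for m
    using le[OF that, of "Suc N"] by (auto simp: in_keys_iff)
  let ?t = "\<lambda>m k. m - expo k + expo (Suc k)"
  \<comment> \<open>The indeterminate \<open>u\<^sub>N\<^sub>+\<^sub>1\<close> can only come from differentiating \<open>u\<^sub>N\<close>.\<close>
  have inj: "m = m0 \<and> k = N"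
    if m: "m \<in> Poly_Mapping.keys P" and k: "k \<in> Poly_Mapping.keys m" and eq: "?t m k = ?t m0 N" for m k
  proof -
    have "Poly_Mapping.lookup (?t m k) (Suc N) = Poly_Mapping.lookup (?t m0 N) (Suc N)"
      using eq by simp
    then have kN: "k = N"
      using above[OF m] above[OF m0(1)] le[OF m k]
      by (auto simp: lookup_add minus_poly_mapping.rep_eq lookup_single when_def split: if_splits)
    with eq have "m - expo N = m0 - expo N"
      by simp
    \<comment> \<open>Since subtraction truncates, \<open>a\<close> can be recovered from
      \<open>a - expo N\<close> only because \<open>N\<close> occurs in \<open>a\<close>.\<close>
    moreover have "a - expo N + expo N = a" if "N \<in> Poly_Mapping.keys a" for a :: "nat \<Rightarrow>\<^sub>0 nat"
      using that by (intro poly_mapping_eqI)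
        (auto simp: lookup_add minus_poly_mapping.rep_eq lookup_single in_keys_iff when_def)
    ultimately show ?thesis
      using k kN m0(2) by metis
  qed
  have "0 = Poly_Mapping.lookup (total_deriv P) (?t m0 N)"
    using assms by simp
  also have "\<dots> = (\<Sum>m\<in>Poly_Mapping.keys P. \<Sum>k\<in>Poly_Mapping.keys m.
      (Poly_Mapping.lookup P m * of_nat (Poly_Mapping.lookup m k) when ?t m k = ?t m0 N))"
    by (simp add: total_deriv_def lookup_sum jet_def mult_single lookup_single)
  also have "\<dots> = (\<Sum>m\<in>Poly_Mapping.keys P. \<Sum>k\<in>Poly_Mapping.keys m.
      if m = m0 \<and> k = N then Poly_Mapping.lookup P m * of_nat (Poly_Mapping.lookup m k) else 0)"
    using inj by (intro sum.cong refl) (auto simp: when_def)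
  also have "\<dots> = (\<Sum>m\<in>Poly_Mapping.keys P.
      if m = m0 then Poly_Mapping.lookup P m * of_nat (Poly_Mapping.lookup m N) else 0)"
    using m0(2) by (intro sum.cong refl) auto
  also have "\<dots> = Poly_Mapping.lookup P m0 * of_nat (Poly_Mapping.lookup m0 N)"
    using m0(1) by simp
  finally show ?thesis
    using m0 by (auto simp: in_keys_iff)
qed

lemma antideriv_total_deriv:
  assumes "const_term Q = 0"
  shows "antideriv (total_deriv Q) = Q"
  unfolding antideriv_def
proof (rule the_equality)
  fix R assume "total_deriv R = total_deriv Q \<and> const_term R = 0"
  then show "R = Q"
    using total_deriv_eq_0D[of "R - Q"] assms by (simp add: total_deriv_diff const_term_diff)
qed (use assms in simp)

text \<open>Any primitive can be normalised by subtracting its constant term, and the normalised one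
  is unique, so the definite description in \<open>antideriv\<close> is proper.\<close>

lemma
  assumes "P \<in> range total_deriv"
  shows total_deriv_antideriv: "total_deriv (antideriv P) = P"
    and const_term_antideriv: "const_term (antideriv P) = 0"
proof -
  from assms obtain R where "P = total_deriv R" by blast
  then have "P = total_deriv (R - const_dp (const_term R))"
    by (simp add: total_deriv_diff)
  moreover have "const_term (R - const_dp (const_term R)) = 0"
    by (simp add: const_term_diff)
  ultimately show "total_deriv (antideriv P) = P" "const_term (antideriv P) = 0"
    by (simp_all add: antideriv_total_deriv)
qed

section \<open>Skew-adjointness and existence of the antiderivatives\<close>

lemma exact_add: "P \<in> range total_deriv \<Longrightarrow> Q \<in> range total_deriv \<Longrightarrow> P + Q \<in> range total_deriv"
  by (auto simp flip: total_deriv_add)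

lemma exact_diff: "P \<in> range total_deriv \<Longrightarrow> Q \<in> range total_deriv \<Longrightarrow> P - Q \<in> range total_deriv"
  by (auto simp flip: total_deriv_diff)

lemma exact_half:
  assumes "2 * P \<in> range total_deriv"
  shows "P \<in> range total_deriv"
proof -
  from assms obtain R where R: "2 * P = total_deriv R" by blast
  have "P = (2 * const_dp (1/2)) * P" by simp
  also have "\<dots> = const_dp (1/2) * (2 * P)" by (simp only: ac_simps)
  also have "\<dots> = total_deriv (const_dp (1/2) * R)"
    by (simp add: R total_deriv_const_mult)
  finally show ?thesis by blast
qed

lemma B_op_skew: "P * B_op Q + Q * B_op P \<in> range total_deriv"
proof
  show "P * B_op Q + Q * B_op P = total_deriv
    (P * total_deriv (total_deriv Q) + Q * total_deriv (total_deriv P)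
      - total_deriv P * total_deriv Q + 4 * jet 0 * P * Q)"
    by (simp add: B_op_def total_deriv_add total_deriv_diff total_deriv_mult algebra_simps)
qed simp

text \<open>The skew-adjointness of \<open>B\<close> and an integration by parts show that, modulo total
  derivatives, \<open>F\<^sub>j B(F\<^sub>k)\<close> depends on \<open>j + k\<close> only and is antisymmetric in \<open>j\<close> and \<open>k\<close>.\<close>

lemma exact_mult_B_op:
  fixes G :: "nat \<Rightarrow> diffpoly"
  assumes G: "\<And>k. k < n \<Longrightarrow> total_deriv (G (Suc k)) = B_op (G k)"
  shows "j + k \<le> n \<Longrightarrow> G j * B_op (G k) \<in> range total_deriv"
proof -
  have shift: "j + k \<le> n \<Longrightarrow> G j * B_op (G k) - G 0 * B_op (G (j + k)) \<in> range total_deriv" for j k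
  proof (induction j arbitrary: k)
    case 0
    show ?case by (simp add: range_eqI[of _ _ 0])
  next
    case (Suc j)
    \<comment> \<open>Integration by parts: \<open>B_op (G k)\<close> and \<open>B_op (G j)\<close>
      are the derivatives of \<open>G (Suc k)\<close> and \<open>G (Suc j)\<close>. Both
      \<open>k\<close> and \<open>j\<close> lie below \<open>n\<close> here.\<close>
    have "G (Suc j) * B_op (G k) - G j * B_op (G (Suc k))
        = total_deriv (G (Suc j) * G (Suc k)) - (G (Suc k) * B_op (G j) + G j * B_op (G (Suc k)))"
      using Suc.prems by (simp add: total_deriv_mult G algebra_simps)
    also have "\<dots> \<in> range total_deriv"
      by (intro exact_diff B_op_skew) simp
    finally have "G (Suc j) * B_op (G k) - G j * B_op (G (Suc k)) \<in> range total_deriv" .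
    from exact_add[OF this Suc.IH[of "Suc k"]] Suc.prems show ?case
      by simp
  qed
  \<comment> \<open>Modulo total derivatives, \<open>G i * B_op (G 0)\<close> equals
    \<open>G 0 * B_op (G i)\<close> by \<open>shift\<close> and its negative by skew-adjointness. So
    twice the product is exact.\<close>
  have base: "G 0 * B_op (G i) \<in> range total_deriv" if "i \<le> n" for i
  proof (rule exact_half)
    have "2 * (G 0 * B_op (G i))
        = (G 0 * B_op (G i) + G i * B_op (G 0)) - (G i * B_op (G 0) - G 0 * B_op (G (i + 0)))"
      by simp
    also have "\<dots> \<in> range total_deriv"
      using that by (intro exact_diff B_op_skew shift) simp
    finally show "2 * (G 0 * B_op (G i)) \<in> range total_deriv" .
  qed
  show "G j * B_op (G k) \<in> range total_deriv" if "j + k \<le> n"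
    using exact_add[OF shift[OF that] base[OF that]] by simp
qed

lemma total_deriv_F_shifted: "total_deriv (F_shifted (Suc n)) = B_op (F_shifted n)"
  and B_op_F_shifted_exact: "B_op (F_shifted n) \<in> range total_deriv"
proof -
  have "B_op (F_shifted n) \<in> range total_deriv" for n
  proof (induction n rule: less_induct)
    case (less n)
    \<comment> \<open>Up to index \<open>n\<close> the recursion is available from the induction
      hypothesis, which is all that \<open>exact_mult_B_op\<close> asks for. As
      \<open>F_shifted 0\<close> is the constant 1/2, adding the product to itself gives
      \<open>B_op (F_shifted n)\<close>.\<close>
    have "F_shifted 0 * B_op (F_shifted n) \<in> range total_deriv"
      by (rule exact_mult_B_op[where n = n]) (simp_all add: total_deriv_antideriv less)
    from exact_add[OF this this] show ?case
      by (simp flip: mult_2 mult.assoc)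
  qed
  then show "total_deriv (F_shifted (Suc n)) = B_op (F_shifted n)"
    and "B_op (F_shifted n) \<in> range total_deriv"
    by (simp_all add: total_deriv_antideriv)
qed

lemma const_term_F_shifted [simp]: "const_term (F_shifted (Suc n)) = 0"
  by (simp add: const_term_antideriv B_op_F_shifted_exact)

text \<open>By the recursion the first factor is \<open>B_op (F_shifted j)\<close>, so this is the
  exactness of the products treated above.\<close>

lemma F_shifted_products_exact: "total_deriv (F_shifted (Suc j)) * F_shifted k \<in> range total_deriv"
  using exact_mult_B_op[of "k + j" F_shifted k j] by (simp only: total_deriv_F_shifted mult.commute)

section \<open>The identity in the ring of differential polynomials\<close>

text \<open>Formal counterpart of \<open>phi\<close>, for a fixed value of the parameter;
  \<open>F_shifted j\<close> is the function of index \<open>j - 1\<close>.\<close>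

definition phi_dp :: "complex \<Rightarrow> nat \<Rightarrow> diffpoly" where
  "phi_dp l n = (\<Sum>j\<le>n. const_dp (4 * l) ^ (n - j) * F_shifted j)"

definition H_dp :: "complex \<Rightarrow> diffpoly \<Rightarrow> diffpoly" where
  "H_dp l P = P * total_deriv (total_deriv P) - const_dp (1/2) * (total_deriv P)\<^sup>2
     + 2 * (jet 0 - const_dp l) * P\<^sup>2"

text \<open>The products of the first and second derivative of \<open>P\<close> cancel, and every
  remaining term contains the factor \<open>P\<close>.\<close>

lemma total_deriv_H_dp:
  "total_deriv (H_dp l P) = P * (B_op P - const_dp (4 * l) * total_deriv P)"
proof -
  let ?d = "total_deriv P * total_deriv (total_deriv P)"
  have "total_deriv (const_dp (1/2) * (total_deriv P)\<^sup>2) = (2 * const_dp (1/2)) * ?d"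
    by (simp only: total_deriv_const_mult power2_eq_square total_deriv_mult)
      (simp only: total_deriv_const mult_zero_left add_0_left mult_2 distrib_left distrib_right
        ac_simps)
  then have half: "total_deriv (const_dp (1/2) * (total_deriv P)\<^sup>2) = ?d"
    by (simp only: half_mult mult_1)
  have "total_deriv (H_dp l P) = total_deriv (P * total_deriv (total_deriv P)) - ?d
      + total_deriv (2 * (jet 0 - const_dp l) * P\<^sup>2)"
    by (simp only: H_dp_def total_deriv_add total_deriv_diff half)
  also have "\<dots> = P * (B_op P - const_dp (4 * l) * total_deriv P)"
    by (simp add: B_op_def total_deriv_diff total_deriv_mult power2_eq_square const_dp_mult
        algebra_simps)
  finally show ?thesis .
qed

text \<open>By the recursion, \<open>4 * l\<close> times the derivative of \<open>phi_dp l n\<close>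
  consists of exactly the terms with \<open>j < n\<close> of \<open>B_op (phi_dp l n)\<close>, so
  only the term \<open>j = n\<close> survives.\<close>

lemma B_op_phi_dp:
  "B_op (phi_dp l n) - const_dp (4 * l) * total_deriv (phi_dp l n) = B_op (F_shifted n)"
proof -
  let ?c = "const_dp (4 * l)"
  have const: "total_deriv (?c ^ k * P) = ?c ^ k * total_deriv P" for k P
    by (simp add: total_deriv_const_mult flip: const_dp_power)
  have "B_op (\<Sum>j\<in>A. f j) = (\<Sum>j\<in>A. B_op (f j))" for A :: "nat set" and f
    by (simp only: B_op_def total_deriv_sum sum_distrib_left sum.distrib)
  moreover have "B_op (?c ^ k * P) = ?c ^ k * B_op P" for k P
    by (simp only: B_op_def const) (simp only: distrib_left ac_simps)
  ultimately have "B_op (phi_dp l n) = (\<Sum>j\<le>n. ?c ^ (n - j) * B_op (F_shifted j))"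
    by (simp only: phi_dp_def)
  moreover have "?c * total_deriv (phi_dp l n) = (\<Sum>j<n. ?c ^ (n - j) * B_op (F_shifted j))"
  proof (cases n)
    case (Suc m)
    \<comment> \<open>The leading term is constant and drops out; the remaining indices move down by
      one, and the missing power of \<open>4 * l\<close> is supplied by the outer factor.\<close>
    have "total_deriv (F_shifted 0) = 0"
      by simp
    then have "total_deriv (phi_dp l n) = (\<Sum>j\<le>m. ?c ^ (m - j) * B_op (F_shifted j))"
      by (simp only: phi_dp_def Suc sum.atMost_Suc_shift total_deriv_add total_deriv_sum const
          total_deriv_F_shifted diff_Suc_Suc mult_zero_right add_0_left)
    moreover have "?c * (?c ^ (m - j) * B_op (F_shifted j)) = ?c ^ (n - j) * B_op (F_shifted j)"
      if "j \<in> {..m}" for j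
      using that by (simp only: Suc Suc_diff_le atMost_iff power_Suc mult.assoc)
    ultimately show ?thesis
      by (simp only: sum_distrib_left Suc lessThan_Suc_atMost cong: sum.cong)
  qed (simp add: phi_dp_def)
  ultimately show ?thesis
    by (simp only: sum.lessThan_Suc diff_self_eq_0 power_0 mult_1 add_diff_cancel_left'
        flip: lessThan_Suc_atMost)
qed

text \<open>Integration by parts: this is the normalised primitive of
  \<open>F_shifted (Suc j)\<close> times the derivative of \<open>F_shifted (Suc n)\<close>.\<close>

definition H_coeff :: "nat \<Rightarrow> nat \<Rightarrow> diffpoly" where
  "H_coeff n j = F_shifted (Suc j) * F_shifted (Suc n)
     - antideriv (total_deriv (F_shifted (Suc j)) * F_shifted (Suc n))"

lemma total_deriv_H_coeff: "total_deriv (H_coeff n j) = F_shifted (Suc j) * B_op (F_shifted n)"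
  unfolding H_coeff_def total_deriv_diff
    total_deriv_antideriv[OF F_shifted_products_exact[of j "Suc n"]]
  by (simp only: total_deriv_mult total_deriv_F_shifted) simp

lemma const_term_H_coeff [simp]: "const_term (H_coeff n j) = 0"
  unfolding H_coeff_def const_term_diff
    const_term_antideriv[OF F_shifted_products_exact[of j "Suc n"]]
  by (simp only: const_term_mult const_term_F_shifted) simp

text \<open>Only the summand \<open>j = 0\<close>, with the constant 1/2, contributes.\<close>

lemma const_term_phi_dp: "const_term (phi_dp l n) = (4 * l) ^ n / 2"
  by (cases n)
    (simp_all add: phi_dp_def sum.atMost_Suc_shift const_term_add const_term_sum const_term_mult
      const_term_power del: F_shifted.simps(2) sum.atMost_Suc)

lemma H_dp_phi_dp:
  "H_dp l (phi_dp l n) =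
     - const_dp ((4 * l) ^ (2 * n + 1) / 8)
     + const_dp ((4 * l) ^ n) * (F_shifted 0 * F_shifted (Suc n))
     + (\<Sum>j<n. const_dp ((4 * l) ^ (n - 1 - j)) * H_coeff n j)" (is "?L = ?R")
proof -
  have phi: "phi_dp l n = const_dp ((4 * l) ^ n) * F_shifted 0
      + (\<Sum>j<n. const_dp ((4 * l) ^ (n - 1 - j)) * F_shifted (Suc j))" (is "_ = ?phi")
    by (cases n) (simp_all add: phi_dp_def sum.atMost_Suc_shift lessThan_Suc_atMost const_dp_power
      const_dp_mult power_mult_distrib del: F_shifted.simps sum.atMost_Suc)
  have "total_deriv ?L = ?phi * B_op (F_shifted n)"
    unfolding total_deriv_H_dp B_op_phi_dp by (simp only: phi)
  also have "\<dots> = total_deriv ?R"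
    unfolding total_deriv_add total_deriv_sum total_deriv_minus total_deriv_const_mult
      total_deriv_const total_deriv_H_coeff total_deriv_mult total_deriv_F_shifted
    by (simp add: sum_distrib_right distrib_right mult.assoc)
  finally have "total_deriv ?L = total_deriv ?R" .
  then have "total_deriv (?L - ?R) = 0"
    by (simp only: total_deriv_diff diff_self)
  then have "?L - ?R = const_dp (const_term (?L - ?R))"
    by (rule total_deriv_eq_0D)
  moreover have "const_term ?L = const_term ?R"
  proof -
    \<comment> \<open>Derivatives and \<open>jet 0\<close> have zero constant term, so only
      \<open>- 2 * l\<close> times the square of \<open>phi_dp l n\<close> is left.\<close>
    have "const_term ?L = - 2 * l * ((4 * l) ^ n / 2)\<^sup>2"
      by (simp only: H_dp_def const_term_add const_term_diff const_term_mult const_term_power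
          const_term_phi_dp) simp
    also have "\<dots> = - ((4 * l) ^ (2 * n + 1) / 8)"
      by (simp only: power_add power_even_eq power_divide power_one_right) simp
    also have "\<dots> = const_term ?R"
      by (simp only: const_term_add const_term_minus const_term_sum const_term_mult const_term_const
          const_term_F_shifted const_term_H_coeff) simp
    finally show ?thesis .
  qed
  ultimately have "?L - ?R = const_dp 0"
    by (metis const_term_diff diff_self)
  then show ?thesis
    by (simp only: const_dp_0 right_minus_eq)
qed

section \<open>Evaluation of differential polynomials at a function\<close>

lemma eval_dp_single:
  "eval_dp q (Poly_Mapping.single m c) x
     = c * (\<Prod>k\<in>Poly_Mapping.keys m. ((ddx ^^ k) q x) ^ Poly_Mapping.lookup m k)"
  by (simp add: eval_dp_def)

lemma eval_dp_const [simp]: "eval_dp q (const_dp c) x = c"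
  by (simp add: const_dp_def eval_dp_single)

lemma eval_dp_jet [simp]: "eval_dp q (jet k) x = (ddx ^^ k) q x"
  by (simp add: jet_def eval_dp_single)

lemma eval_dp_add: "eval_dp q (P + Q) x = eval_dp q P x + eval_dp q Q x"
  unfolding eval_dp_def
  by (rule setsum_keys_plus_distrib) (simp_all add: algebra_simps)

lemma eval_dp_mult: "eval_dp q (P * Q) x = eval_dp q P x * eval_dp q Q x"
proof (induction P rule: poly_mapping_single_add_induct)
  case (single m c)
  show ?case
  proof (induction Q rule: poly_mapping_single_add_induct)
    case (single n d)
    let ?K = "Poly_Mapping.keys m \<union> Poly_Mapping.keys n"
    let ?p = "\<lambda>a A. \<Prod>k\<in>A. ((ddx ^^ k) q x) ^ Poly_Mapping.lookup a k"
    \<comment> \<open>All three products are extended to the common index set \<open>?K\<close>; the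
      new factors have exponent 0.\<close>
    have "?p m (Poly_Mapping.keys m) = ?p m ?K" "?p n (Poly_Mapping.keys n) = ?p n ?K"
      "?p (m + n) (Poly_Mapping.keys (m + n)) = ?p (m + n) ?K"
      by (rule prod.mono_neutral_left; auto simp: in_keys_iff lookup_add)+
    then show ?case
      by (simp add: mult_single eval_dp_single lookup_add power_add prod.distrib)
  qed (simp add: eval_dp_add algebra_simps)
qed (simp add: eval_dp_add algebra_simps)

lemma eval_dp_minus: "eval_dp q (- P) x = - eval_dp q P x"
  using eval_dp_mult[of q "const_dp (-1)" P x] const_dp_diff[of 0 1] by simp

lemma eval_dp_diff: "eval_dp q (P - Q) x = eval_dp q P x - eval_dp q Q x"
  using eval_dp_add[of q P "- Q" x] by (simp add: eval_dp_minus)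

lemma eval_dp_sum: "eval_dp q (\<Sum>i\<in>A. f i) x = (\<Sum>i\<in>A. eval_dp q (f i) x)"
  by (induction A rule: infinite_finite_induct) (simp_all add: eval_dp_add flip: const_dp_0)

text \<open>Evaluation turns the formal derivation into d/dx. Both sides obey the sum and Leibniz
  rules, and on a jet the claim is the smoothness of \<open>q\<close>.\<close>

lemma eval_dp_has_vector_derivative:
  assumes "smooth_on I q" "x \<in> I"
  shows "(eval_dp q P has_vector_derivative eval_dp q (total_deriv P) x) (at x)"
proof (induction P rule: diffpoly_induct)
  case (const c)
  have "eval_dp q (const_dp c) = (\<lambda>_. c)"
    by auto
  then show ?case
    using eval_dp_const[of q 0 x] by (simp del: eval_dp_const)
next
  case (jet k)
  have "eval_dp q (jet k) = (ddx ^^ k) q"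
    by auto
  then show ?case
    using assms by (simp add: smooth_on_def ddx_def vector_derivative_works)
next
  case (add P Q)
  have "eval_dp q (P + Q) = (\<lambda>x. eval_dp q P x + eval_dp q Q x)"
    by (simp add: fun_eq_iff eval_dp_add)
  then show ?case
    using has_vector_derivative_add[OF add] by (simp add: total_deriv_add eval_dp_add)
next
  case (mult P Q)
  have "eval_dp q (P * Q) = (\<lambda>x. eval_dp q P x * eval_dp q Q x)"
    by (simp add: fun_eq_iff eval_dp_mult)
  then show ?case
    using has_vector_derivative_mult[OF mult]
    by (simp add: total_deriv_mult eval_dp_add eval_dp_mult add.commute)
qed

lemma H_op_eval_dp:
  assumes "open I" "smooth_on I q" "x \<in> I"
  shows "H_op q l (eval_dp q P) x = eval_dp q (H_dp l P) x"
proof -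
  have d: "ddx (eval_dp q P) y = eval_dp q (total_deriv P) y" if "y \<in> I" for P y
    using eval_dp_has_vector_derivative[OF assms(2) that]
    by (simp add: ddx_def vector_derivative_at)
  \<comment> \<open>The formula for the first derivative is known only on \<open>I\<close>; openness
    of \<open>I\<close> allows it to be differentiated once more.\<close>
  have "(ddx (eval_dp q P) has_vector_derivative eval_dp q (total_deriv (total_deriv P)) x) (at x)"
    by (rule has_vector_derivative_transform_within_open
        [OF eval_dp_has_vector_derivative[OF assms(2,3)] assms(1,3)]) (simp add: d)
  then have "ddx (ddx (eval_dp q P)) x = eval_dp q (total_deriv (total_deriv P)) x"
    unfolding ddx_def[of "ddx _"] by (rule vector_derivative_at)
  moreover have "eval_dp q 2 x = 2"
    by (metis const_dp_numeral eval_dp_const)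
  ultimately show ?thesis
    by (simp add: H_op_def H_dp_def d[OF assms(3)] eval_dp_add eval_dp_diff eval_dp_mult
        power2_eq_square)
qed

lemma phi_eq_eval_dp: "phi q l n = eval_dp q (phi_dp l n)"
  by (simp add: fun_eq_iff phi_def phi_dp_def F_def eval_dp_sum eval_dp_mult atMost_atLeast0
      flip: const_dp_power)

theorem theorem7p6:
  fixes I :: "real set" and q :: "real \<Rightarrow> complex" and n :: nat
  assumes "open I" and "is_interval I" and "smooth_on I q"
  shows "\<forall>x\<in>I. \<forall>l::complex.
    H_op q l (phi q l n) x =
      - ((4 * l) ^ (2 * n + 1) * (eval_dp q (F (-1)) x)\<^sup>2 / 2)
      + (4 * l) ^ n * eval_dp q (F (-1)) x * eval_dp q (F (int n)) x
      + (\<Sum>j<n. (4 * l) ^ (n - 1 - j) *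
          (eval_dp q (F (int j)) x * eval_dp q (F (int n)) x
           - eval_dp q (antideriv (total_deriv (F (int j)) * F (int n))) x))"
proof (intro ballI allI)
  fix x l assume x: "x \<in> I"
  have F: "F (- 1) = const_dp (1/2)" "F (int k) = F_shifted (Suc k)" for k
    by (simp_all add: F_def nat_add_distrib del: F_shifted.simps(2))
  have "H_op q l (phi q l n) x = eval_dp q (H_dp l (phi_dp l n)) x"
    unfolding phi_eq_eval_dp by (rule H_op_eval_dp[OF assms(1,3) x])
  then show "H_op q l (phi q l n) x =
      - ((4 * l) ^ (2 * n + 1) * (eval_dp q (F (-1)) x)\<^sup>2 / 2)
      + (4 * l) ^ n * eval_dp q (F (-1)) x * eval_dp q (F (int n)) x
      + (\<Sum>j<n. (4 * l) ^ (n - 1 - j) *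
          (eval_dp q (F (int j)) x * eval_dp q (F (int n)) x
           - eval_dp q (antideriv (total_deriv (F (int j)) * F (int n))) x))"
    \<comment> \<open>Since \<open>F (- 1)\<close> evaluates to 1/2, half of its square is the
      factor 1/8 of the formal identity.\<close>
    by (simp only: H_dp_phi_dp F H_coeff_def F_shifted.simps(1) eval_dp_add eval_dp_minus
        eval_dp_mult eval_dp_diff eval_dp_sum eval_dp_const)
      (simp only: power2_eq_square divide_simps, simp)
qed

end
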